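(* Let $1\le k<n$ be integers, and consider the Stiefel manifold of real $n\times k$ matrices $Q$ with $Q^{\top}Q=1$, as a homogeneous space for $\mathrm{SO}(n)$ acting by $R\cdot Q=RQ$, with origin $Q_0=\begin{bmatrix}0\\ 1\end{bmatrix}$ (the lower block being the $k\times k$ identity). Let $\mathfrak m\subset\mathfrak{so}(n)$ be the space of matrices of the form $$\begin{bmatrix}0&W\\-W^{\top}&\Omega\end{bmatrix},\qquad W\in\mathbf R^{(n-k)\times k},\quad\Omega\in\mathfrak{so}(k).$$ The space $\mathfrak m$ is a reductive structure. The associated connection, at a tangent vector $\delta Q$ at a point $Q$, is $$\langle\omega,\delta Q\rangle_Q=\delta Q\,Q^{\top}-Q\,\delta Q^{\top}+Q\,\delta Q^{\top}Q\,Q^{\top}.$$ The connection is symmetric if and only if $k=1$, i.e., if the Stiefel manifold is a sphere, in which case the connection simplifies into $$\langle\omega,\delta Q\rangle_Q=\delta Q\,Q^{\top}-Q\,\delta Q^{\top}.$$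
   Context: For a Lie group $G$ with Lie algebra $\mathfrak g$ acting smoothly and transitively on a manifold $M$ (infinitesimal action $\xi\cdot x\in T_xM$, tangent map $Tg$ of $x\mapsto g\cdot x$, adjoint action $g\cdot\xi=g\xi g^{-1}$), with fixed origin $o\in M$, isotropy group $H$ of $o$ and Lie algebra $\mathfrak h$ of $H$: - a connection is a $\mathfrak g$-valued one-form $\omega\in\Omega^1(M,\mathfrak g)$ such that $\langle\omega,f\rangle_x\cdot x=f$ for all $x\in M$, $f\in T_xM$, and $\langle\omega,Tg\,f\rangle_{g\cdot x}=g\cdot\langle\omega,f\rangle_x$ for all $g\in G$; - a reductive structure is a subspace $\mathfrak m\subset\mathfrak g$ with $\mathfrak g=\mathfrak h\oplus\mathfrak m$ and $H\cdot\mathfrak m\subset\mathfrak m$; the connection $\omega$ associated to $\mathfrak m$ is the unique one with $\omega(T_oM)=\mathfrak m$; - the connection (or $\mathfrak m$) is symmetric if $[\mathfrak m,\mathfrak m]\subset\mathfrak h$. In the present case $\mathfrak g=\mathfrak{so}(n)$, the space of skew-symmetric matrices, and $H$ consists of the matrices $\begin{bmatrix}R&0\\0&1\end{bmatrix}$ with $R\in\mathrm{SO}(n-k)$. *)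

theory Defs
  imports "HOL-Analysis.Analysis"
begin

section \<open>Smooth maps and tangent spaces in Euclidean space\<close>

text \<open>Only meant for open \<open>U\<close>.\<close>

primrec Ck_on :: "nat \<Rightarrow> ('a::real_normed_vector \<Rightarrow> 'b::real_normed_vector) \<Rightarrow> 'a set \<Rightarrow> bool"
where
  "Ck_on 0 f U \<longleftrightarrow> continuous_on U f"
| "Ck_on (Suc r) f U \<longleftrightarrow>
     (\<forall>x\<in>U. f differentiable (at x)) \<and>
     (\<forall>v. Ck_on r (\<lambda>x. frechet_derivative f (at x) v) U)"

text \<open>A map on an arbitrary subset of Euclidean space is smooth if it extends, near every point
  of the subset, to a smooth map on an open set. On an embedded submanifold this is smoothness
  in charts.\<close>

definition smooth_map_on ::
  "'a::real_normed_vector set \<Rightarrow> ('a \<Rightarrow> 'b::real_normed_vector) \<Rightarrow> bool" where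
  "smooth_map_on S f \<longleftrightarrow>
     (\<forall>x\<in>S. \<exists>U F. open U \<and> x \<in> U \<and> (\<forall>r. Ck_on r F U) \<and> (\<forall>y\<in>S \<inter> U. F y = f y))"

definition tangent_space :: "'a::real_normed_vector set \<Rightarrow> 'a \<Rightarrow> 'a set" where
  "tangent_space M x =
     {v. \<exists>(\<gamma>::real \<Rightarrow> 'a) \<epsilon>. \<epsilon> > 0 \<and> smooth_map_on {-\<epsilon><..<\<epsilon>} \<gamma> \<and> \<gamma> ` {-\<epsilon><..<\<epsilon>} \<subseteq> M \<and>
         \<gamma> 0 = x \<and> (\<gamma> has_vector_derivative v) (at 0)}"

definition tangent_bundle :: "'a::real_normed_vector set \<Rightarrow> ('a \<times> 'a) set" where
  "tangent_bundle M = Sigma M (tangent_space M)"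


section \<open>Homogeneous spaces of matrix groups\<close>

text \<open>The group is a set \<open>G\<close> of real matrices and \<open>M\<close> a subset of a Euclidean space. The action
  \<open>act\<close> is a function on the ambient spaces, differentiable there; the derivatives below are
  only used in directions tangent to \<open>G\<close> and \<open>M\<close>, where they do not depend on how the action is
  extended to the ambient spaces.\<close>

definition lie_algebra :: "(real^'n^'n) set \<Rightarrow> (real^'n^'n) set" where
  "lie_algebra G = tangent_space G (mat 1)"

definition adjoint_action :: "real^'n^'n \<Rightarrow> real^'n^'n \<Rightarrow> real^'n^'n" where
  "adjoint_action g \<xi> = g ** \<xi> ** matrix_inv g"

definition lie_bracket :: "real^'n^'n \<Rightarrow> real^'n^'n \<Rightarrow> real^'n^'n" where
  "lie_bracket \<xi> \<eta> = \<xi> ** \<eta> - \<eta> ** \<xi>"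

definition isotropy_group :: "(real^'n^'n) set \<Rightarrow> (real^'n^'n \<Rightarrow> 'x \<Rightarrow> 'x) \<Rightarrow> 'x \<Rightarrow> (real^'n^'n) set"
where
  "isotropy_group G act p = {g \<in> G. act g p = p}"

definition infinitesimal_action ::
  "(real^'n^'n \<Rightarrow> 'x \<Rightarrow> 'x::euclidean_space) \<Rightarrow> real^'n^'n \<Rightarrow> 'x \<Rightarrow> 'x" where
  "infinitesimal_action act \<xi> x = frechet_derivative (\<lambda>g. act g x) (at (mat 1)) \<xi>"

definition tangent_map ::
  "(real^'n^'n \<Rightarrow> 'x \<Rightarrow> 'x::euclidean_space) \<Rightarrow> real^'n^'n \<Rightarrow> 'x \<Rightarrow> 'x \<Rightarrow> 'x" where
  "tangent_map act g x f = frechet_derivative (\<lambda>y. act g y) (at x) f"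

text \<open>A subgroup of the general linear group that is closed in it is a Lie group, and a closed
  orbit of a smooth action is an embedded submanifold.\<close>

definition homogeneous_space ::
  "(real^'n^'n) set \<Rightarrow> (real^'n^'n \<Rightarrow> 'x \<Rightarrow> 'x::euclidean_space) \<Rightarrow> 'x set \<Rightarrow> 'x \<Rightarrow> bool" where
  "homogeneous_space G act M p \<longleftrightarrow>
     closedin (top_of_set {g. invertible g}) G \<and> mat 1 \<in> G \<and>
     (\<forall>g\<in>G. \<forall>h\<in>G. g ** h \<in> G) \<and> (\<forall>g\<in>G. matrix_inv g \<in> G) \<and>
     closed M \<and> p \<in> M \<and>
     (\<forall>g\<in>G. \<forall>x\<in>M. act g x \<in> M) \<and>
     (\<forall>x\<in>M. act (mat 1) x = x) \<and>
     (\<forall>g\<in>G. \<forall>h\<in>G. \<forall>x\<in>M. act (g ** h) x = act g (act h x)) \<and>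
     smooth_map_on (G \<times> M) (\<lambda>(g, x). act g x) \<and>
     (\<forall>x\<in>M. \<forall>y\<in>M. \<exists>g\<in>G. act g x = y)"

definition reductive_structure ::
  "(real^'n^'n) set \<Rightarrow> (real^'n^'n \<Rightarrow> 'x \<Rightarrow> 'x) \<Rightarrow> 'x \<Rightarrow> (real^'n^'n) set \<Rightarrow> bool" where
  "reductive_structure G act p \<mm> \<longleftrightarrow>
     (let \<gg> = lie_algebra G; H = isotropy_group G act p; \<hh> = lie_algebra H in
        subspace \<mm> \<and> \<mm> \<subseteq> \<gg> \<and>
        \<gg> = {a + b |a b. a \<in> \<hh> \<and> b \<in> \<mm>} \<and> \<hh> \<inter> \<mm> = {0} \<and>
        (\<forall>g\<in>H. \<forall>\<xi>\<in>\<mm>. adjoint_action g \<xi> \<in> \<mm>))"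

text \<open>One-forms and connections are represented by functions \<open>\<omega> x f\<close> whose values matter only
  for \<open>x\<close> in \<open>M\<close> and \<open>f\<close> tangent to \<open>M\<close> at \<open>x\<close>.\<close>

definition one_form :: "(real^'n^'n) set \<Rightarrow> 'x::euclidean_space set \<Rightarrow> ('x \<Rightarrow> 'x \<Rightarrow> real^'n^'n) \<Rightarrow> bool"
where
  "one_form \<gg> M \<omega> \<longleftrightarrow>
     (\<forall>x\<in>M. \<forall>f\<in>tangent_space M x. \<omega> x f \<in> \<gg>) \<and>
     (\<forall>x\<in>M. \<forall>f\<in>tangent_space M x. \<forall>f'\<in>tangent_space M x. \<forall>a b.
        \<omega> x (a *\<^sub>R f + b *\<^sub>R f') = a *\<^sub>R \<omega> x f + b *\<^sub>R \<omega> x f') \<and>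
     smooth_map_on (tangent_bundle M) (\<lambda>(x, f). \<omega> x f)"

definition connection ::
  "(real^'n^'n) set \<Rightarrow> (real^'n^'n \<Rightarrow> 'x \<Rightarrow> 'x::euclidean_space) \<Rightarrow> 'x set
     \<Rightarrow> ('x \<Rightarrow> 'x \<Rightarrow> real^'n^'n) \<Rightarrow> bool" where
  "connection G act M \<omega> \<longleftrightarrow>
     one_form (lie_algebra G) M \<omega> \<and>
     (\<forall>x\<in>M. \<forall>f\<in>tangent_space M x. infinitesimal_action act (\<omega> x f) x = f) \<and>
     (\<forall>g\<in>G. \<forall>x\<in>M. \<forall>f\<in>tangent_space M x.
        \<omega> (act g x) (tangent_map act g x f) = adjoint_action g (\<omega> x f))"

definition is_associated_connection ::
  "(real^'n^'n) set \<Rightarrow> (real^'n^'n \<Rightarrow> 'x \<Rightarrow> 'x::euclidean_space) \<Rightarrow> 'x set \<Rightarrow> 'x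
     \<Rightarrow> (real^'n^'n) set \<Rightarrow> ('x \<Rightarrow> 'x \<Rightarrow> real^'n^'n) \<Rightarrow> bool" where
  "is_associated_connection G act M p \<mm> \<omega> \<longleftrightarrow>
     connection G act M \<omega> \<and> \<omega> p ` tangent_space M p = \<mm> \<and>
     (\<forall>\<omega>'. connection G act M \<omega>' \<and> \<omega>' p ` tangent_space M p = \<mm> \<longrightarrow>
        (\<forall>x\<in>M. \<forall>f\<in>tangent_space M x. \<omega>' x f = \<omega> x f))"

definition symmetric_connection ::
  "(real^'n^'n) set \<Rightarrow> (real^'n^'n \<Rightarrow> 'x \<Rightarrow> 'x::euclidean_space) \<Rightarrow> 'x set \<Rightarrow> 'x
     \<Rightarrow> ('x \<Rightarrow> 'x \<Rightarrow> real^'n^'n) \<Rightarrow> bool" where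
  "symmetric_connection G act M p \<omega> \<longleftrightarrow>
     (let \<mm> = \<omega> p ` tangent_space M p in
        \<forall>\<xi>\<in>\<mm>. \<forall>\<eta>\<in>\<mm>. lie_bracket \<xi> \<eta> \<in> lie_algebra (isotropy_group G act p))"


section \<open>The Stiefel manifold\<close>

definition SO_group :: "(real^'n^'n) set" where
  "SO_group = {R. rotation_matrix R}"

definition stiefel :: "(real^'k^'n) set" where
  "stiefel = {Q. transpose Q ** Q = mat 1}"

text \<open>Rows are indexed by the disjoint sum \<open>'m + 'k\<close>, where \<open>'m\<close> has \<open>n - k\<close> elements and \<open>'k\<close> has
  \<open>k\<close> elements; \<open>Inl\<close> and \<open>Inr\<close> indicate the first and the second block.\<close>

definition stiefel_origin :: "real^'k^('m::finite + 'k::finite)" where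
  "stiefel_origin = (\<chi> i j. case i of Inl _ \<Rightarrow> 0 | Inr b \<Rightarrow> (mat 1 :: real^'k^'k) $ b $ j)"

definition block_matrix ::
  "real^'m^'m \<Rightarrow> real^'k^'m \<Rightarrow> real^'m^'k \<Rightarrow> real^'k^'k
     \<Rightarrow> real^('m::finite + 'k::finite)^('m + 'k)" where
  "block_matrix A B C D = (\<chi> i j.
     case i of
       Inl a \<Rightarrow> (case j of Inl a' \<Rightarrow> A $ a $ a' | Inr b' \<Rightarrow> B $ a $ b')
     | Inr b \<Rightarrow> (case j of Inl a' \<Rightarrow> C $ b $ a' | Inr b' \<Rightarrow> D $ b $ b'))"

definition stiefel_complement :: "(real^('m::finite + 'k::finite)^('m + 'k)) set" where
  "stiefel_complement =
     {block_matrix 0 W (- transpose W) \<Omega> |(W :: real^'k^'m) (\<Omega> :: real^'k^'k). transpose \<Omega> = - \<Omega>}"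

end

theory Submission
  imports Defs
begin

text \<open>The form \<open>\<delta>Q Q\<^sup>T - Q \<delta>Q\<^sup>T + Q \<delta>Q\<^sup>T Q Q\<^sup>T\<close> is skew-symmetric, equivariant and
  sends \<open>Q\<close> to \<open>\<delta>Q\<close> whenever \<open>Q\<^sup>T \<delta>Q\<close> is skew. At the origin its image is the complement
  \<open>\<mm>\<close>, and \<open>\<xi> \<in> \<mm>\<close> is recovered from \<open>\<xi> Q\<^sub>0\<close> by applying it; the splitting of
  \<open>so(n)\<close>, the invariance of \<open>\<mm>\<close> and the uniqueness of the connection all follow from this.
  The tangent spaces are computed with Cayley transforms: for skew \<open>\<xi>\<close> the curve
  \<open>(1 - t \<xi> / 2)\<^sup>-\<^sup>1 (1 + t \<xi> / 2)\<close> lies in \<open>SO(n)\<close>, has velocity \<open>\<xi>\<close> at \<open>0\<close>, and fixes every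
  matrix that \<open>\<xi>\<close> annihilates. For symmetry, brackets of elements of \<open>\<mm>\<close> with \<open>\<Omega> = 0\<close> have
  lower block \<open>W\<^sub>2\<^sup>T W\<^sub>1 - W\<^sub>1\<^sup>T W\<^sub>2\<close>, which vanishes identically only for \<open>k = 1\<close>.\<close>

subsection \<open>Smooth maps\<close>

text \<open>Since \<open>U\<close> is open, agreement on \<open>U\<close> is agreement near each of
  its points, so both functions have the same derivatives there and the induction passes to the
  directional derivatives.\<close>

lemma Ck_on_cong:
  assumes "open U" "\<And>x. x \<in> U \<Longrightarrow> f x = g x"
  shows "Ck_on r f U \<longleftrightarrow> Ck_on r g U"
  using assms
proof (induction r arbitrary: f g)
  case 0
  then show ?case by (auto cong: continuous_on_cong)
next
  case (Suc r)
  have D: "(f has_derivative D) (at x) \<longleftrightarrow> (g has_derivative D) (at x)" if "x \<in> U" for x D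
    using has_derivative_transform_within_open[of f D x UNIV U g]
      has_derivative_transform_within_open[of g D x UNIV U f] Suc.prems that by auto
  have diff: "f differentiable at x \<longleftrightarrow> g differentiable at x" if "x \<in> U" for x
    using D[OF that] by (simp add: differentiable_def)
  have "frechet_derivative f (at x) = frechet_derivative g (at x)" if "x \<in> U" for x
    using D[OF that] by (simp add: frechet_derivative_def)
  then have "Ck_on r (\<lambda>x. frechet_derivative f (at x) v) U
      \<longleftrightarrow> Ck_on r (\<lambda>x. frechet_derivative g (at x) v) U" for v
    by (intro Suc.IH[OF Suc.prems(1)]) simp
  with diff show ?case by simp
qed

lemma Ck_on_SucD: "Ck_on (Suc r) f U \<Longrightarrow> Ck_on r f U"
proof (induction r arbitrary: f)
  case 0
  then show ?case
    by (auto intro!: continuous_at_imp_continuous_on dest: differentiable_imp_continuous_within)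
next
  case (Suc r)
  then show ?case by (metis Ck_on.simps(2))
qed

text \<open>Allows an explicit derivative in place of the chosen \<open>frechet_derivative\<close>;
  uniqueness of derivatives identifies the two on \<open>U\<close>.\<close>

lemma Ck_on_SucI:
  assumes "open U" "\<And>x. x \<in> U \<Longrightarrow> (f has_derivative f' x) (at x)"
    and "\<And>v. Ck_on r (\<lambda>x. f' x v) U"
  shows "Ck_on (Suc r) f U"
proof -
  have eq: "frechet_derivative f (at x) v = f' x v" if "x \<in> U" for x v
    using assms(2)[OF that] frechet_derivative_at by metis
  have "Ck_on r (\<lambda>x. frechet_derivative f (at x) v) U" for v
    using Ck_on_cong[OF assms(1), of "\<lambda>x. frechet_derivative f (at x) v" "\<lambda>x. f' x v"] eq assms(3)
    by blast
  with assms(2) show ?thesis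
    by (auto simp: differentiable_def)
qed

lemma Ck_on_SucE:
  assumes "Ck_on (Suc r) f U"
  obtains f' where "\<And>x. x \<in> U \<Longrightarrow> (f has_derivative f' x) (at x)"
    and "\<And>v. Ck_on r (\<lambda>x. f' x v) U"
  using that[of "\<lambda>x. frechet_derivative f (at x)"] assms
  by (auto simp: frechet_derivative_works[symmetric])

lemma Ck_on_const: "open U \<Longrightarrow> Ck_on r (\<lambda>x. c) U"
proof (induction r arbitrary: c)
  case (Suc r)
  then show ?case
    using Ck_on_SucI[of U "\<lambda>_. c" "\<lambda>_ _. 0"] by simp
qed auto

lemma Ck_on_bounded_linear:
  assumes "bounded_linear f" "open U"
  shows "Ck_on r f U"
proof (cases r)
  case 0
  then show ?thesis
    using assms linear_continuous_on by auto
next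
  case (Suc s)
  have "(f has_derivative f) (at x)" for x
    using assms(1) by (rule bounded_linear_imp_has_derivative)
  then show ?thesis
    unfolding Suc using Ck_on_SucI[OF assms(2), of f "\<lambda>_. f"] Ck_on_const[OF assms(2)] by metis
qed

lemma Ck_on_add:
  assumes "open U" "Ck_on r f U" "Ck_on r g U"
  shows "Ck_on r (\<lambda>x. f x + g x) U"
  using assms
proof (induction r arbitrary: f g)
  case 0
  then show ?case by (auto intro: continuous_intros)
next
  case (Suc r)
  obtain f' where f': "\<And>x. x \<in> U \<Longrightarrow> (f has_derivative f' x) (at x)"
    "\<And>v. Ck_on r (\<lambda>x. f' x v) U" using Ck_on_SucE[OF Suc.prems(2)] by blast
  obtain g' where g': "\<And>x. x \<in> U \<Longrightarrow> (g has_derivative g' x) (at x)"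
    "\<And>v. Ck_on r (\<lambda>x. g' x v) U" using Ck_on_SucE[OF Suc.prems(3)] by blast
  show ?case
    by (rule Ck_on_SucI[where f' = "\<lambda>x v. f' x v + g' x v"])
      (use Suc f' g' in \<open>auto intro: has_derivative_add\<close>)
qed

text \<open>The product rule produces sums of \<open>B\<close> applied to one function and a
  derivative of the other, so the induction has to run over all pairs \<open>f\<close>,
  \<open>g\<close>.\<close>

lemma Ck_on_bilinear:
  assumes "bounded_bilinear B" "open U" "Ck_on r f U" "Ck_on r g U"
  shows "Ck_on r (\<lambda>x. B (f x) (g x)) U"
  using assms(3,4)
proof (induction r arbitrary: f g)
  case 0
  then show ?case using bounded_bilinear.continuous_on[OF assms(1)] by auto
next
  case (Suc r)
  obtain f' where f': "\<And>x. x \<in> U \<Longrightarrow> (f has_derivative f' x) (at x)"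
    "\<And>v. Ck_on r (\<lambda>x. f' x v) U" using Ck_on_SucE[OF Suc.prems(1)] by blast
  obtain g' where g': "\<And>x. x \<in> U \<Longrightarrow> (g has_derivative g' x) (at x)"
    "\<And>v. Ck_on r (\<lambda>x. g' x v) U" using Ck_on_SucE[OF Suc.prems(2)] by blast
  show ?case
  proof (rule Ck_on_SucI[where f' = "\<lambda>x v. B (f x) (g' x v) + B (f' x v) (g x)"])
    show "((\<lambda>x. B (f x) (g x)) has_derivative (\<lambda>v. B (f x) (g' x v) + B (f' x v) (g x))) (at x)"
      if "x \<in> U" for x
      using bounded_bilinear.FDERIV[OF assms(1) f'(1)[OF that] g'(1)[OF that]] .
    show "Ck_on r (\<lambda>x. B (f x) (g' x v) + B (f' x v) (g x)) U" for v
      using Suc.IH Suc.prems[THEN Ck_on_SucD] f'(2) g'(2) assms(2)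
      by (intro Ck_on_add) auto
  qed fact
qed

lemma Ck_on_linear_comp:
  assumes "bounded_linear L" "open U" "Ck_on r f U"
  shows "Ck_on r (\<lambda>x. L (f x)) U"
  using assms(3)
proof (induction r arbitrary: f)
  case 0
  then show ?case using bounded_linear.continuous_on[OF assms(1)] by auto
next
  case (Suc r)
  obtain f' where f': "\<And>x. x \<in> U \<Longrightarrow> (f has_derivative f' x) (at x)"
    "\<And>v. Ck_on r (\<lambda>x. f' x v) U" using Ck_on_SucE[OF Suc.prems] by blast
  show ?case
    by (rule Ck_on_SucI[where f' = "\<lambda>x v. L (f' x v)"])
      (use assms f' Suc.IH in \<open>auto intro: bounded_linear.has_derivative\<close>)
qed

lemma smooth_map_on_global:
  assumes "\<And>r. Ck_on r f UNIV"
  shows "smooth_map_on S f"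
  unfolding smooth_map_on_def using assms by blast


subsection \<open>Matrix algebra\<close>

text \<open>Source of all the calculus below: distributivity, continuity, product rule and
  smoothness of matrix products of any shape are instances of it.\<close>

lemma bounded_bilinear_matrix_mul:
  "bounded_bilinear ((**) :: real^'a^'b \<Rightarrow> real^'c^'a \<Rightarrow> real^'c^'b)"
  unfolding bilinear_conv_bounded_bilinear[symmetric] bilinear_def
  by (auto intro!: linearI simp: vec_eq_iff matrix_matrix_mult_def sum.distrib sum_distrib_left
      algebra_simps)

lemma bounded_linear_transpose: "bounded_linear (transpose :: real^'a^'b \<Rightarrow> real^'b^'a)"
  by (intro linear_conv_bounded_linear[THEN iffD1] linearI)
    (auto simp: transpose_def vec_eq_iff)

lemmas matrix_mul_linear_simps =
  bounded_bilinear.add_left[OF bounded_bilinear_matrix_mul]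
  bounded_bilinear.add_right[OF bounded_bilinear_matrix_mul]
  bounded_bilinear.diff_left[OF bounded_bilinear_matrix_mul]
  bounded_bilinear.diff_right[OF bounded_bilinear_matrix_mul]
  bounded_bilinear.minus_left[OF bounded_bilinear_matrix_mul]
  bounded_bilinear.minus_right[OF bounded_bilinear_matrix_mul]
  bounded_bilinear.scaleR_left[OF bounded_bilinear_matrix_mul]
  bounded_bilinear.scaleR_right[OF bounded_bilinear_matrix_mul]
  bounded_bilinear.zero_left[OF bounded_bilinear_matrix_mul]
  bounded_bilinear.zero_right[OF bounded_bilinear_matrix_mul]

lemmas transpose_linear_simps = linear_add[OF bounded_linear_transpose[THEN bounded_linear.linear]]
  linear_diff[OF bounded_linear_transpose[THEN bounded_linear.linear]]
  linear_neg[OF bounded_linear_transpose[THEN bounded_linear.linear]]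
  linear_scale[OF bounded_linear_transpose[THEN bounded_linear.linear]]
  linear_0[OF bounded_linear_transpose[THEN bounded_linear.linear]]

lemmas matrix_algebra_simps =
  matrix_mul_linear_simps transpose_linear_simps matrix_transpose_mul matrix_mul_assoc

lemma Ck_on_matrix_mul:
  fixes f :: "'x::real_normed_vector \<Rightarrow> real^'a^'b" and g :: "'x \<Rightarrow> real^'c^'a"
  assumes "Ck_on r f UNIV" "Ck_on r g UNIV"
  shows "Ck_on r (\<lambda>x. f x ** g x) UNIV"
  using Ck_on_bilinear[OF bounded_bilinear_matrix_mul] assms by blast

lemma matrix_left_inverse_unique:
  fixes A B :: "real^'n^'n"
  assumes "B ** A = mat 1"
  shows "matrix_inv A = B"
proof -
  have "invertible A" using assms by (auto simp: invertible_left_inverse)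
  \<comment> \<open>\<open>matrix_inv\<close> is a choice of two-sided inverse, so its property
    comes from existence.\<close>
  then have "A ** matrix_inv A = mat 1" by (simp add: matrix_inv_def invertible_def) (metis (mono_tags, lifting) someI_ex)
  then show ?thesis by (metis assms matrix_mul_assoc matrix_mul_lid matrix_mul_rid)
qed

lemma SO_group_iff: "R \<in> SO_group \<longleftrightarrow> transpose R ** R = mat 1 \<and> det R = 1"
  by (simp add: SO_group_def rotation_matrix_def orthogonal_matrix)

lemma orthogonal_transpose_right:
  fixes R :: "real^'n^'n"
  shows "transpose R ** R = mat 1 \<Longrightarrow> R ** transpose R = mat 1"
  by (simp add: matrix_left_right_inverse)


subsection \<open>The Cayley transform\<close>

text \<open>Moving \<open>\<xi>\<close> to the other side of the inner product changes the sign, so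
  the number equals its own negative.\<close>

lemma skew_inner_zero:
  fixes \<xi> :: "real^'n^'n"
  assumes "transpose \<xi> = - \<xi>"
  shows "x \<bullet> (\<xi> *v x) = 0"
proof -
  have "x \<bullet> (\<xi> *v x) = (transpose \<xi> *v x) \<bullet> x"
    by (simp add: dot_lmul_matrix)
  also have "\<dots> = - (x \<bullet> (\<xi> *v x))"
    unfolding assms by (simp add: inner_commute vec_eq_iff matrix_vector_mult_def sum_negf inner_vec_def)
  finally show ?thesis by simp
qed

text \<open>Pythagoras, because \<open>\<xi> *v x\<close> is orthogonal to \<open>x\<close>. This
  yields both invertibility for every real \<open>t\<close> and a bound on the inverse that is
  uniform in \<open>t\<close>.\<close>

lemma norm_le_skew_perturbation:
  fixes \<xi> :: "real^'n^'n"
  assumes "transpose \<xi> = - \<xi>"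
  shows "norm x \<le> norm ((mat 1 - t *\<^sub>R \<xi>) *v x)"
proof -
  have "(mat 1 - t *\<^sub>R \<xi>) *v x = x - t *\<^sub>R (\<xi> *v x)"
    by (simp add: matrix_vector_mult_diff_rdistrib scaleR_matrix_vector_assoc)
  moreover have "x \<bullet> (t *\<^sub>R (\<xi> *v x)) = 0" "(t *\<^sub>R (\<xi> *v x)) \<bullet> x = 0"
    using skew_inner_zero[OF assms, of x] by (simp_all add: inner_commute[of _ x])
  ultimately have "(norm ((mat 1 - t *\<^sub>R \<xi>) *v x))\<^sup>2 = (norm x)\<^sup>2 + (norm (t *\<^sub>R (\<xi> *v x)))\<^sup>2"
    by (simp only: power2_norm_eq_inner inner_diff_left inner_diff_right)
  then show ?thesis
    by (metis le_add_same_cancel1 norm_ge_zero power2_le_imp_le zero_le_power2)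
qed

lemma invertible_skew_perturbation:
  fixes \<xi> :: "real^'n^'n"
  assumes "transpose \<xi> = - \<xi>"
  shows "invertible (mat 1 - t *\<^sub>R \<xi>)"
proof -
  have "x = 0" if "(mat 1 - t *\<^sub>R \<xi>) *v x = 0" for x
    using norm_le_skew_perturbation[OF assms, of x t] that by simp
  then show ?thesis
    by (simp add: invertible_left_inverse matrix_left_invertible_ker)
qed

text \<open>The building block of the Cayley transform, isolated because the resolvent identity
  gives its dependence on \<open>t\<close>.\<close>

definition skew_resolvent :: "real^'n^'n \<Rightarrow> real \<Rightarrow> real^'n^'n" where
  "skew_resolvent \<xi> t = matrix_inv (mat 1 - t *\<^sub>R \<xi>)"

context
  fixes \<xi> :: "real^'n^'n"
  assumes skew: "transpose \<xi> = - \<xi>"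
begin

lemma skew_resolvent_left: "skew_resolvent \<xi> t ** (mat 1 - t *\<^sub>R \<xi>) = mat 1"
  and skew_resolvent_right: "(mat 1 - t *\<^sub>R \<xi>) ** skew_resolvent \<xi> t = mat 1"
proof -
  obtain B where "B ** (mat 1 - t *\<^sub>R \<xi>) = mat 1"
    using invertible_skew_perturbation[OF skew] invertible_def by metis
  with matrix_left_inverse_unique[OF this]
  show "skew_resolvent \<xi> t ** (mat 1 - t *\<^sub>R \<xi>) = mat 1" by (simp add: skew_resolvent_def)
  then show "(mat 1 - t *\<^sub>R \<xi>) ** skew_resolvent \<xi> t = mat 1"
    by (simp add: matrix_left_right_inverse)
qed

text \<open>The resolvent identity:
  \<open>(mat 1 - t *\<^sub>R \<xi>) - (mat 1 - s *\<^sub>R \<xi>)\<close> equals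
  \<open>(s - t) *\<^sub>R \<xi>\<close>, and it is multiplied by the two inverses.\<close>

lemma skew_resolvent_diff:
  "skew_resolvent \<xi> s - skew_resolvent \<xi> t
     = (s - t) *\<^sub>R (skew_resolvent \<xi> s ** \<xi> ** skew_resolvent \<xi> t)"
proof -
  let ?B = "skew_resolvent \<xi>"
  have "?B s - ?B t = ?B s ** ((mat 1 - t *\<^sub>R \<xi>) ** ?B t) - ?B s ** (mat 1 - s *\<^sub>R \<xi>) ** ?B t"
    by (simp add: skew_resolvent_left skew_resolvent_right)
  also have "\<dots> = (s - t) *\<^sub>R (?B s ** \<xi> ** ?B t)"
    by (simp add: matrix_algebra_simps algebra_simps)
  finally show ?thesis .
qed

lemma transpose_skew_resolvent: "transpose (skew_resolvent \<xi> t) = skew_resolvent \<xi> (- t)"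
proof -
  have "transpose ((mat 1 - t *\<^sub>R \<xi>) ** skew_resolvent \<xi> t) = mat 1"
    by (simp add: skew_resolvent_right)
  then have "transpose (skew_resolvent \<xi> t) ** (mat 1 - (- t) *\<^sub>R \<xi>) = mat 1"
    using skew by (simp add: matrix_transpose_mul transpose_linear_simps)
  then show ?thesis
    by (simp add: matrix_left_inverse_unique skew_resolvent_def)
qed

text \<open>A row at \<open>t\<close> is a column at \<open>- t\<close>, hence the image of a unit
  vector under a map that does not increase norms; the norm of the matrix is at most the sum over
  its rows.\<close>

lemma norm_skew_resolvent_le: "norm (skew_resolvent \<xi> t) \<le> CARD('n)"
proof -
  have "norm (skew_resolvent \<xi> t $ i) \<le> 1" for i
  proof -
    have "skew_resolvent \<xi> t $ i = skew_resolvent \<xi> (- t) *v axis i 1"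
      by (simp add: transpose_skew_resolvent[symmetric] matrix_vector_mult_basis column_def
          transpose_def vec_eq_iff del: transpose_matrix_vector)
    moreover have "norm (skew_resolvent \<xi> (- t) *v axis i 1)
        \<le> norm ((mat 1 - (- t) *\<^sub>R \<xi>) *v (skew_resolvent \<xi> (- t) *v axis i 1))"
      by (rule norm_le_skew_perturbation[OF skew])
    ultimately show ?thesis
      by (simp add: matrix_vector_mul_assoc skew_resolvent_right del: scaleR_minus_left)
  qed
  then have "(\<Sum>i\<in>UNIV. norm (skew_resolvent \<xi> t $ i)) \<le> (\<Sum>i\<in>(UNIV :: 'n set). 1)"
    by (intro sum_mono)
  then show ?thesis
    unfolding norm_vec_def by (intro order_trans[OF L2_set_le_sum]) auto
qed

lemma continuous_skew_resolvent: "(skew_resolvent \<xi> \<longlongrightarrow> skew_resolvent \<xi> t) (at t)"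
proof -
  let ?B = "skew_resolvent \<xi>"
  obtain K where K: "K > 0" "\<And>a b. norm ((a :: real^'n^'n) ** (b :: real^'n^'n)) \<le> norm a * norm b * K"
    using bounded_bilinear.pos_bounded[OF bounded_bilinear_matrix_mul] by blast
  \<comment> \<open>A Lipschitz constant at \<open>t\<close>: the uniform bound on the resolvent at
    \<open>s\<close>, the norm of the remaining fixed factor, and the constant \<open>K\<close> of
    the product.\<close>
  define C where "C = real CARD('n) * norm (\<xi> ** ?B t) * K"
  have "norm (?B s - ?B t) \<le> \<bar>s - t\<bar> * C" for s
  proof -
    have "norm (?B s ** \<xi> ** ?B t) \<le> norm (?B s) * norm (\<xi> ** ?B t) * K"
      using K(2)[of "?B s" "\<xi> ** ?B t"] by (simp add: matrix_mul_assoc)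
    also have "\<dots> \<le> C"
      unfolding C_def using norm_skew_resolvent_le K(1)
      by (intro mult_right_mono) auto
    finally show ?thesis
      by (simp add: skew_resolvent_diff[of s t] mult_left_mono)
  qed
  moreover have "((\<lambda>s. \<bar>s - t\<bar> * C) \<longlongrightarrow> 0) (at t)"
    by (auto intro!: tendsto_eq_intros)
  ultimately have "((\<lambda>s. ?B s - ?B t) \<longlongrightarrow> 0) (at t)"
    by (rule Lim_null_comparison[OF always_eventually[OF allI]])
  then show ?thesis by (simp add: LIM_zero_iff)
qed

text \<open>By the resolvent identity the difference quotient is
  \<open>?B s ** \<xi> ** ?B t\<close>, and continuity gives its limit.\<close>

lemma has_vector_derivative_skew_resolvent:
  "(skew_resolvent \<xi> has_vector_derivative (skew_resolvent \<xi> t ** \<xi> ** skew_resolvent \<xi> t)) (at t)"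
proof -
  let ?B = "skew_resolvent \<xi>"
  have "((\<lambda>s. ?B s ** \<xi> ** ?B t) \<longlongrightarrow> ?B t ** \<xi> ** ?B t) (at t)"
    by (intro bounded_bilinear.tendsto[OF bounded_bilinear_matrix_mul] continuous_skew_resolvent
        tendsto_const)
  then have "((\<lambda>s. norm (?B s ** \<xi> ** ?B t - ?B t ** \<xi> ** ?B t)) \<longlongrightarrow> 0) (at t)"
    by (simp add: LIM_zero_iff tendsto_norm_zero)
  then have "((\<lambda>s. norm (?B s - ?B t - (s - t) *\<^sub>R (?B t ** \<xi> ** ?B t)) / norm (s - t)) \<longlongrightarrow> 0) (at t)"
    by (rule Lim_transform_eventually)
      (auto simp: eventually_at_filter skew_resolvent_diff[of _ t] scaleR_diff_right[symmetric])
  then show ?thesis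
    by (simp add: has_vector_derivative_def has_derivative_iff_norm bounded_linear_scaleR_left)
qed

text \<open>The derivative is a product built from the resolvent itself, so each order of smoothness
  yields the next.\<close>

lemma Ck_on_skew_resolvent: "Ck_on r (skew_resolvent \<xi>) UNIV"
proof (induction r)
  case 0
  then show ?case
    by (auto simp: continuous_on_eq_continuous_at continuous_at continuous_skew_resolvent)
next
  case (Suc r)
  show ?case
  proof (rule Ck_on_SucI)
    show "(skew_resolvent \<xi> has_derivative
        (\<lambda>v. v *\<^sub>R (skew_resolvent \<xi> t ** \<xi> ** skew_resolvent \<xi> t))) (at t)" for t
      using has_vector_derivative_skew_resolvent by (simp add: has_vector_derivative_def)
    show "Ck_on r (\<lambda>t. v *\<^sub>R (skew_resolvent \<xi> t ** \<xi> ** skew_resolvent \<xi> t)) UNIV" for v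
      by (intro Ck_on_linear_comp[OF bounded_linear_scaleR_right] Ck_on_matrix_mul Suc Ck_on_const)
        auto
  qed auto
qed

end

text \<open>A substitute for the exponential: only a smooth curve in the group with prescribed
  velocity is required. The last clause keeps the curve in the isotropy group of \<open>X\<close>
  when \<open>\<xi>\<close> annihilates \<open>X\<close>.\<close>

lemma obtain_rotation_curve:
  fixes \<xi> :: "real^'n^'n"
  assumes skew: "transpose \<xi> = - \<xi>"
  obtains c :: "real \<Rightarrow> real^'n^'n" where "\<And>r. Ck_on r c UNIV" "c 0 = mat 1"
    "(c has_vector_derivative \<xi>) (at 0)" "\<And>t. c t \<in> SO_group"
    "\<And>t (X :: real^'k^'n). \<xi> ** X = 0 \<Longrightarrow> c t ** X = X"
proof -
  \<comment> \<open>Both factors of the Cayley transform contribute \<open>\<eta>\<close> to the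
    velocity at \<open>0\<close>, hence the factor one half.\<close>
  define \<eta> where "\<eta> = (1/2) *\<^sub>R \<xi>"
  have \<eta>: "transpose \<eta> = - \<eta>"
    using skew by (simp add: \<eta>_def transpose_linear_simps)
  let ?B = "skew_resolvent \<eta>"
  define c where "c t = ?B t ** (mat 1 + t *\<^sub>R \<eta>)" for t
  \<comment> \<open>As \<open>1 + t \<eta> = 2 - (1 - t \<eta>)\<close>, the curve is affine in the
    resolvent and inherits its smoothness and derivative.\<close>
  have c_eq: "c t = 2 *\<^sub>R ?B t - mat 1" for t
  proof -
    have "?B t - t *\<^sub>R (?B t ** \<eta>) = mat 1"
      using skew_resolvent_left[OF \<eta>, of t] by (simp add: matrix_mul_linear_simps)
    then show ?thesis
      by (simp add: c_def matrix_mul_linear_simps algebra_simps scaleR_2)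
  qed
  have B0: "?B 0 = mat 1"
    using skew_resolvent_left[OF \<eta>, of 0] by simp
  show thesis
  proof (rule that)
    show "c 0 = mat 1" by (simp add: c_def B0)
    show "Ck_on r c UNIV" for r
    proof -
      have "Ck_on r (\<lambda>t. 2 *\<^sub>R ?B t + (- mat 1)) UNIV"
        by (intro Ck_on_add Ck_on_linear_comp[OF bounded_linear_scaleR_right] Ck_on_const
            Ck_on_skew_resolvent[OF \<eta>]) auto
      then show ?thesis by (simp add: c_eq[abs_def])
    qed
    have "((\<lambda>t. 2 *\<^sub>R ?B t - mat 1) has_vector_derivative 2 *\<^sub>R (?B 0 ** \<eta> ** ?B 0) - 0) (at 0)"
      by (intro has_vector_derivative_diff has_vector_derivative_const
          bounded_linear.has_vector_derivative[OF bounded_linear_scaleR_right]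
          has_vector_derivative_skew_resolvent[OF \<eta>])
    then show "(c has_vector_derivative \<xi>) (at 0)"
      by (simp add: c_eq[abs_def] B0) (simp add: \<eta>_def)
    show "c t \<in> SO_group" for t
    proof -
      have "transpose (c t) = (mat 1 - t *\<^sub>R \<eta>) ** ?B (- t)"
        by (simp add: c_def matrix_transpose_mul transpose_linear_simps \<eta> transpose_skew_resolvent[OF \<eta>])
      then have "c t ** transpose (c t) = ?B t ** ((mat 1 + t *\<^sub>R \<eta>) ** (mat 1 - t *\<^sub>R \<eta>)) ** ?B (- t)"
        by (simp only: c_def matrix_mul_assoc)
      \<comment> \<open>The two factors commute; after the swap each one stands next to its own
        inverse.\<close>
      also have "(mat 1 + t *\<^sub>R \<eta>) ** (mat 1 - t *\<^sub>R \<eta>) = (mat 1 - t *\<^sub>R \<eta>) ** (mat 1 - (- t) *\<^sub>R \<eta>)"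
        by (simp add: matrix_mul_linear_simps algebra_simps)
      also have "?B t ** \<dots> ** ?B (- t) = ?B t ** (mat 1 - t *\<^sub>R \<eta>) ** ((mat 1 - (- t) *\<^sub>R \<eta>) ** ?B (- t))"
        by (simp only: matrix_mul_assoc)
      finally have orth: "c t ** transpose (c t) = mat 1"
        by (simp only: skew_resolvent_left[OF \<eta>] skew_resolvent_right[OF \<eta>] matrix_mul_lid)
      \<comment> \<open>A matrix and its transpose have equal determinants, so the two factors of
        \<open>c t\<close> have reciprocal determinants and the value is exactly
        \<open>1\<close>.\<close>
      have "mat 1 + t *\<^sub>R \<eta> = transpose (mat 1 - t *\<^sub>R \<eta>)"
        by (simp add: transpose_linear_simps \<eta>)
      then have "det (c t) = det (?B t) * det (mat 1 - t *\<^sub>R \<eta>)"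
        by (simp add: c_def det_mul del: transpose_mat)
      also have "\<dots> = det (?B t ** (mat 1 - t *\<^sub>R \<eta>))"
        by (simp add: det_mul)
      finally have "det (c t) = 1"
        by (simp add: skew_resolvent_left[OF \<eta>])
      with orth show ?thesis
        by (simp add: SO_group_iff matrix_left_right_inverse)
    qed
    show "c t ** X = X" if "\<xi> ** X = 0" for t and X :: "real^'k^'n"
    proof -
      have "\<eta> ** X = 0" using that by (simp add: \<eta>_def matrix_mul_linear_simps)
      then have *: "(mat 1 + s *\<^sub>R \<eta>) ** X = X" for s
        by (simp add: matrix_mul_linear_simps)
      \<comment> \<open>The fact \<open>*\<close> at \<open>- t\<close> replaces \<open>X\<close> by
        \<open>(mat 1 - t *\<^sub>R \<eta>) ** X\<close>, which the resolvent undoes.\<close>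
      have "?B t ** X = ?B t ** (mat 1 - t *\<^sub>R \<eta>) ** X"
        using *[of "- t"] by (simp add: matrix_mul_assoc[symmetric])
      then have "?B t ** X = X"
        by (simp add: skew_resolvent_left[OF \<eta>])
      with * show ?thesis
        by (simp add: c_def matrix_mul_assoc[symmetric])
    qed
  qed
qed

subsection \<open>Tangent spaces\<close>

lemma tangent_space_mono: "M \<subseteq> N \<Longrightarrow> tangent_space M x \<subseteq> tangent_space N x"
  unfolding tangent_space_def by blast

lemma tangent_spaceI:
  assumes "\<And>r. Ck_on r \<gamma> UNIV" "\<And>t. \<gamma> t \<in> M" "\<gamma> 0 = x" "(\<gamma> has_vector_derivative v) (at 0)"
  shows "v \<in> tangent_space M x"
  unfolding tangent_space_def
  using assms smooth_map_on_global by (intro CollectI exI[of _ \<gamma>] exI[of _ 1]) auto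

text \<open>Differentiates a constant along a curve by the product rule; for the Gram matrix this
  linearises the orthonormality of the columns.\<close>

lemma tangent_space_bilinear_level:
  assumes "bounded_bilinear B" "\<And>y. y \<in> M \<Longrightarrow> B y y = c" "v \<in> tangent_space M x"
  shows "B x v + B v x = 0"
proof -
  obtain \<gamma> \<epsilon> where \<gamma>: "\<epsilon> > 0" "\<gamma> ` {-\<epsilon><..<\<epsilon>} \<subseteq> M" "\<gamma> 0 = x"
    "(\<gamma> has_vector_derivative v) (at (0::real))"
    using assms(3) unfolding tangent_space_def by blast
  have "((\<lambda>t. B (\<gamma> t) (\<gamma> t)) has_vector_derivative B x v + B v x) (at 0)"
    using bounded_bilinear.has_vector_derivative[OF assms(1) \<gamma>(4,4)] \<gamma>(3) by simp
  then have "((\<lambda>t. c) has_vector_derivative B x v + B v x) (at (0::real))"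
  proof (rule has_vector_derivative_transform_within_open)
    show "B (\<gamma> t) (\<gamma> t) = c" if "t \<in> {-\<epsilon><..<\<epsilon>}" for t
      using assms(2) \<gamma>(2) that by blast
  qed (use \<gamma>(1) in auto)
  then show ?thesis
    using vector_derivative_unique_at has_vector_derivative_const by blast
qed

lemma tangent_space_linear_level:
  assumes "bounded_linear L" "\<And>y. y \<in> M \<Longrightarrow> L y = c" "v \<in> tangent_space M x"
  shows "L v = 0"
proof -
  obtain \<gamma> \<epsilon> where \<gamma>: "\<epsilon> > 0" "\<gamma> ` {-\<epsilon><..<\<epsilon>} \<subseteq> M" "\<gamma> 0 = x"
    "(\<gamma> has_vector_derivative v) (at (0::real))"
    using assms(3) unfolding tangent_space_def by blast
  have "((\<lambda>t. L (\<gamma> t)) has_vector_derivative L v) (at 0)"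
    using bounded_linear.has_vector_derivative[OF assms(1) \<gamma>(4)] .
  then have "((\<lambda>t. c) has_vector_derivative L v) (at (0::real))"
  proof (rule has_vector_derivative_transform_within_open)
    show "L (\<gamma> t) = c" if "t \<in> {-\<epsilon><..<\<epsilon>}" for t
      using assms(2) \<gamma>(2) that by blast
  qed (use \<gamma>(1) in auto)
  then show ?thesis
    using vector_derivative_unique_at has_vector_derivative_const by blast
qed

lemma bounded_bilinear_gram:
  "bounded_bilinear (\<lambda>(A :: real^'a^'n) (B :: real^'b^'n). transpose A ** B)"
  using bounded_bilinear.comp1[OF bounded_bilinear_matrix_mul bounded_linear_transpose] .

text \<open>The shape of the matrices is arbitrary: at the square identity matrix this gives
  skew-symmetry of the Lie algebra.\<close>

lemma tangent_space_stiefel_subset: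
  assumes "f \<in> tangent_space stiefel Q"
  shows "transpose f ** Q = - (transpose Q ** f)"
  using tangent_space_bilinear_level[OF bounded_bilinear_gram, of stiefel "mat 1" f Q] assms
  by (simp add: stiefel_def eq_neg_iff_add_eq_0 add.commute)

definition so_algebra :: "(real^'n^'n) set" where
  "so_algebra = {\<xi>. transpose \<xi> = - \<xi>}"

text \<open>One computation gives both Lie algebras, with \<open>X\<close> the origin for the
  isotropy algebra and \<open>X = 0\<close> for the whole of \<open>SO_group\<close>.
  Differentiating the defining equations gives one inclusion, the Cayley curve the other.\<close>

lemma lie_algebra_isotropy:
  fixes X :: "real^'k^'n"
  shows "lie_algebra (isotropy_group SO_group (**) X) = {\<xi> \<in> so_algebra. \<xi> ** X = 0}"
proof (intro set_eqI iffI)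
  fix \<xi> :: "real^'n^'n"
  assume *: "\<xi> \<in> lie_algebra (isotropy_group SO_group (**) X)"
  \<comment> \<open>Square Stiefel matrices are exactly the orthogonal ones.\<close>
  have "isotropy_group SO_group (**) X \<subseteq> stiefel"
    by (auto simp: isotropy_group_def SO_group_iff stiefel_def)
  with * have "\<xi> \<in> tangent_space stiefel (mat 1)"
    unfolding lie_algebra_def using tangent_space_mono by blast
  then have "\<xi> \<in> so_algebra"
    using tangent_space_stiefel_subset[of \<xi> "mat 1"] by (simp add: so_algebra_def)
  moreover have "\<xi> ** X = 0"
  proof (rule tangent_space_linear_level[where L = "\<lambda>y. y ** X"])
    show "bounded_linear (\<lambda>y. y ** X)"
      by (rule bounded_bilinear.bounded_linear_left[OF bounded_bilinear_matrix_mul])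
    show "\<xi> \<in> tangent_space (isotropy_group SO_group (**) X) (mat 1)"
      using * by (simp add: lie_algebra_def)
  qed (simp add: isotropy_group_def)
  ultimately show "\<xi> \<in> {\<xi> \<in> so_algebra. \<xi> ** X = 0}" by simp
next
  fix \<xi> :: "real^'n^'n"
  assume *: "\<xi> \<in> {\<xi> \<in> so_algebra. \<xi> ** X = 0}"
  then have skew: "transpose \<xi> = - \<xi>" by (simp add: so_algebra_def)
  show "\<xi> \<in> lie_algebra (isotropy_group SO_group (**) X)"
    using obtain_rotation_curve[OF skew] * tangent_spaceI
    unfolding lie_algebra_def isotropy_group_def
    by (smt (verit, ccfv_threshold) mem_Collect_eq)
qed

lemma lie_algebra_SO: "lie_algebra (SO_group :: (real^'n^'n) set) = so_algebra"
proof -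
  have "isotropy_group SO_group (**) (0 :: real^'n^'n) = SO_group"
    by (auto simp: isotropy_group_def matrix_mul_linear_simps)
  with lie_algebra_isotropy[of "0 :: real^'n^'n"] show ?thesis
    by (simp add: matrix_mul_linear_simps)
qed


subsection \<open>The connection\<close>

text \<open>For tangent \<open>f\<close>, the first two terms count the part of \<open>f\<close> in
  the column span of \<open>Q\<close> twice; the last term takes one copy away.\<close>

definition stiefel_form :: "real^'k^'n \<Rightarrow> real^'k^'n \<Rightarrow> real^'n^'n" where
  "stiefel_form Q f = f ** transpose Q - Q ** transpose f + Q ** transpose f ** Q ** transpose Q"

lemma bounded_linear_stiefel_form: "bounded_linear (stiefel_form Q)"
  unfolding stiefel_form_def linear_conv_bounded_linear[symmetric]
  by (intro linearI) (simp_all add: matrix_algebra_simps algebra_simps)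

lemma SO_inverse:
  assumes "g \<in> SO_group"
  shows "transpose g ** g = mat 1" "g ** transpose g = mat 1" "matrix_inv g = transpose g"
  using assms orthogonal_transpose_right matrix_left_inverse_unique by (auto simp: SO_group_iff)

lemma SO_mul_stiefel:
  assumes "g \<in> SO_group" "Q \<in> stiefel"
  shows "g ** Q \<in> stiefel"
proof -
  have "transpose (g ** Q) ** (g ** Q) = transpose Q ** (transpose g ** g) ** Q"
    by (simp only: matrix_transpose_mul matrix_mul_assoc)
  then show ?thesis
    using assms by (simp add: SO_inverse stiefel_def)
qed

text \<open>In every term the inner products \<open>transpose g ** g\<close> cancel, leaving
  \<open>g\<close> on the left and \<open>transpose g\<close> on the right.\<close>

lemma stiefel_form_equivariant:
  fixes Q f :: "real^'k^'n"
  assumes "g \<in> SO_group"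
  shows "stiefel_form (g ** Q) (g ** f) = adjoint_action g (stiefel_form Q f)"
proof -
  have *: "X ** transpose g ** g = X" for X :: "real^'n^'b"
    by (simp add: matrix_mul_assoc[symmetric] SO_inverse[OF assms])
  show ?thesis
    by (simp add: stiefel_form_def adjoint_action_def SO_inverse[OF assms] matrix_algebra_simps *)
qed

context
  fixes Q f :: "real^'k^'n"
  assumes Q: "Q \<in> stiefel" and f: "transpose f ** Q = - (transpose Q ** f)"
begin

text \<open>The first two terms together are skew; the third is \<open>transpose f ** Q\<close>,
  skew by tangency, conjugated by \<open>Q\<close>.\<close>

lemma stiefel_form_skew: "stiefel_form Q f \<in> so_algebra"
proof -
  have "Q ** transpose Q ** f ** transpose Q = - (Q ** transpose f ** Q ** transpose Q)"
    using f by (simp add: matrix_mul_assoc[symmetric] matrix_mul_linear_simps)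
  then show ?thesis
    by (simp add: so_algebra_def stiefel_form_def matrix_algebra_simps)
qed

text \<open>With \<open>transpose Q ** Q = mat 1\<close> the second and third terms cancel after
  multiplication by \<open>Q\<close>.\<close>

lemma stiefel_form_action: "stiefel_form Q f ** Q = f"
proof -
  have *: "X ** transpose Q ** Q = X" for X :: "real^'k^'b"
    using Q by (simp add: matrix_mul_assoc[symmetric] stiefel_def)
  show ?thesis
    by (simp add: stiefel_form_def matrix_algebra_simps *)
qed

end

text \<open>For the converse inclusion the form supplies a skew \<open>\<xi>\<close> with
  \<open>\<xi> ** Q = f\<close>, and its Cayley curve applied to \<open>Q\<close> has velocity
  \<open>f\<close>.\<close>

lemma tangent_space_stiefel:
  fixes Q :: "real^'k^'n"
  assumes Q: "Q \<in> stiefel"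
  shows "tangent_space stiefel Q = {f. transpose f ** Q = - (transpose Q ** f)}"
proof (intro set_eqI iffI)
  fix f assume "f \<in> {f. transpose f ** Q = - (transpose Q ** f)}"
  then have f: "transpose f ** Q = - (transpose Q ** f)" by simp
  define \<xi> where "\<xi> = stiefel_form Q f"
  have "transpose \<xi> = - \<xi>"
    using stiefel_form_skew[OF Q f] by (simp add: so_algebra_def \<xi>_def)
  then obtain c where c: "\<And>r. Ck_on r c UNIV" "c 0 = mat 1"
    "(c has_vector_derivative \<xi>) (at 0)" "\<And>t. c t \<in> SO_group"
    using obtain_rotation_curve by metis
  show "f \<in> tangent_space stiefel Q"
  proof (rule tangent_spaceI[where \<gamma> = "\<lambda>t. c t ** Q"])
    show "Ck_on r (\<lambda>t. c t ** Q) UNIV" for r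
      by (intro Ck_on_matrix_mul c Ck_on_const) auto
    show "c t ** Q \<in> stiefel" for t
      using SO_mul_stiefel c(4) Q .
    show "((\<lambda>t. c t ** Q) has_vector_derivative f) (at 0)"
      using bounded_linear.has_vector_derivative[OF
          bounded_bilinear.bounded_linear_left[OF bounded_bilinear_matrix_mul, of Q] c(3)]
      stiefel_form_action[OF Q f] by (simp add: \<xi>_def)
  qed (simp add: c)
qed (use tangent_space_stiefel_subset in auto)

section \<open>Derivatives of the action, which is linear in each variable\<close>

lemma infinitesimal_action_matrix_mul: "infinitesimal_action (**) \<xi> x = \<xi> ** x"
proof -
  have "((\<lambda>g. g ** x) has_derivative (\<lambda>g. g ** x)) (at (mat 1))"
    by (intro bounded_linear_imp_has_derivative
        bounded_bilinear.bounded_linear_left[OF bounded_bilinear_matrix_mul])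
  then show ?thesis
    unfolding infinitesimal_action_def using frechet_derivative_at by metis
qed

lemma tangent_map_matrix_mul: "tangent_map (**) g x f = g ** f"
proof -
  have "((\<lambda>y. g ** y) has_derivative (\<lambda>y. g ** y)) (at x)"
    by (intro bounded_linear_imp_has_derivative
        bounded_bilinear.bounded_linear_right[OF bounded_bilinear_matrix_mul])
  then show ?thesis
    unfolding tangent_map_def using frechet_derivative_at by metis
qed

lemma connection_stiefel_form:
  "connection SO_group (**) (stiefel :: (real^'k^'n) set) stiefel_form"
proof -
  have Cfst: "Ck_on r (\<lambda>p :: (real^'k^'n) \<times> (real^'k^'n). fst p) UNIV"
    and Csnd: "Ck_on r (\<lambda>p :: (real^'k^'n) \<times> (real^'k^'n). snd p) UNIV" for r
    by (auto intro: Ck_on_bounded_linear bounded_linear_fst bounded_linear_snd)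
  note Ct = Ck_on_linear_comp[OF bounded_linear_transpose open_UNIV]
  \<comment> \<open>The form is polynomial in the pair of ambient matrices, so one global extension
    serves the whole tangent bundle.\<close>
  have "Ck_on r (\<lambda>p :: (real^'k^'n) \<times> (real^'k^'n). snd p ** transpose (fst p)
      + - (fst p ** transpose (snd p)) + fst p ** transpose (snd p) ** fst p ** transpose (fst p)) UNIV" for r
    by (intro Ck_on_add Ck_on_matrix_mul Ct Cfst Csnd open_UNIV
        Ck_on_linear_comp[OF bounded_linear_minus[OF bounded_linear_ident]])
  then have "smooth_map_on (tangent_bundle stiefel)
      (\<lambda>(x :: real^'k^'n, f :: real^'k^'n). stiefel_form x f)"
    by (intro smooth_map_on_global) (simp add: stiefel_form_def case_prod_unfold)
  then show ?thesis
    unfolding connection_def one_form_def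
    by (auto simp: lie_algebra_SO tangent_space_stiefel stiefel_form_skew stiefel_form_action
        infinitesimal_action_matrix_mul tangent_map_matrix_mul stiefel_form_equivariant
        linear_add[OF bounded_linear_stiefel_form[THEN bounded_linear.linear]]
        linear_scale[OF bounded_linear_stiefel_form[THEN bounded_linear.linear]])
qed

subsection \<open>Transitivity\<close>

lemma sum_UNIV_sum:
  "(\<Sum>x\<in>UNIV. g x) = (\<Sum>a\<in>UNIV. g (Inl a)) + (\<Sum>b\<in>UNIV. g (Inr b))"
  for g :: "'m::finite + 'k::finite \<Rightarrow> 'b::comm_monoid_add"
  by (simp add: UNIV_Plus_UNIV[symmetric] sum.Plus del: UNIV_Plus_UNIV)

lemma stiefel_origin_component:
  "stiefel_origin $ Inl a $ j = 0" "stiefel_origin $ Inr b $ j = (if b = j then 1 else 0)"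
  by (simp_all add: stiefel_origin_def mat_def)

lemma mul_stiefel_origin: "(A ** stiefel_origin) $ i $ j = A $ i $ Inr j"
  by (simp add: matrix_matrix_mult_def sum_UNIV_sum stiefel_origin_component if_distrib cong: if_cong)

lemma transpose_stiefel_origin_mul: "(transpose stiefel_origin ** A) $ i $ j = A $ Inr i $ j"
  by (simp add: matrix_matrix_mult_def transpose_def sum_UNIV_sum stiefel_origin_component
      if_distrib if_distribR cong: if_cong)

lemma mul_transpose_stiefel_origin:
  "(A ** transpose stiefel_origin) $ i $ Inl a = 0"
  "(A ** transpose stiefel_origin) $ i $ Inr b = A $ i $ b"
  by (simp_all add: matrix_matrix_mult_def transpose_def stiefel_origin_component if_distrib
      cong: if_cong)

lemma stiefel_origin_mul:
  "(stiefel_origin ** A) $ Inl a $ j = 0"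
  "(stiefel_origin ** A) $ Inr b $ j = A $ b $ j"
  by (simp_all add: matrix_matrix_mult_def stiefel_origin_component if_distrib if_distribR
      cong: if_cong)

lemma stiefel_origin_in_stiefel: "stiefel_origin \<in> stiefel"
  by (simp add: stiefel_def vec_eq_iff transpose_stiefel_origin_mul stiefel_origin_component mat_def)

text \<open>The orthonormal columns of \<open>Q\<close> are completed to an orthonormal basis. A
  wrong determinant is repaired by negating one added column, which exists because \<open>'m\<close>
  is nonempty.\<close>

lemma rotation_to_stiefel:
  fixes Q :: "real^'k^('m::finite + 'k::finite)"
  assumes "Q \<in> stiefel"
  obtains R where "R \<in> SO_group" "R ** stiefel_origin = Q"
proof -
  have col: "column i Q \<bullet> column j Q = (if i = j then 1 else 0)" for i j
    using assms by (simp add: stiefel_def matrix_mult_transpose_dot_column mat_def vec_eq_iff)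
  define S where "S = range (\<lambda>i. column i Q)"
  \<comment> \<open>Equal columns with distinct indices would have inner product \<open>1\<close>
    and \<open>0\<close> at once; hence \<open>S\<close> has as many elements as there are
    indices.\<close>
  have "inj (\<lambda>i. column i Q)"
    by (rule injI) (metis col zero_neq_one)
  then have "card S = CARD('k)" by (simp add: S_def card_image)
  moreover have "pairwise orthogonal S"
    by (auto simp: S_def pairwise_def orthogonal_def col)
  moreover have "0 \<notin> S"
  proof
    assume "0 \<in> S"
    then obtain i where "column i Q = 0" by (auto simp: S_def)
    with col[of i i] show False by simp
  qed
  ultimately have "dim S = CARD('k)"
    using pairwise_orthogonal_independent dim_eq_card_independent by metis
  \<comment> \<open>The orthogonal complement of the columns; its dimension is the size of
    \<open>'m\<close>, so an orthonormal basis of it can be indexed by \<open>'m\<close>.\<close>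
  define T where "T = {y \<in> UNIV. \<forall>x\<in>span S. orthogonal x y}"
  have "dim T + dim (span S) = dim (UNIV :: (real^('m + 'k)) set)"
    unfolding T_def by (rule dim_subspace_orthogonal_to_vectors) auto
  then have "dim T = CARD('m)"
    using \<open>dim S = CARD('k)\<close> by (simp add: UNIV_Plus_UNIV[symmetric] card_Plus del: UNIV_Plus_UNIV)
  have "subspace T"
    unfolding T_def by (auto simp: subspace_def orthogonal_clauses)
  then obtain B where B: "B \<subseteq> T" "pairwise orthogonal B" "\<And>x. x \<in> B \<Longrightarrow> norm x = 1"
    "independent B" "card B = dim T" "span B = T"
    using orthonormal_basis_subspace by metis
  then have "finite B" using independent_imp_finite by blast
  then obtain u where u: "bij_betw u (UNIV :: 'm set) B"
    using finite_same_card_bij B(5) \<open>dim T = CARD('m)\<close> by (metis finite)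
  have uB: "u a \<in> B" for a using u by (auto simp: bij_betw_def)
  have uu: "u a \<bullet> u a' = (if a = a' then 1 else 0)" for a a'
  proof (cases "a = a'")
    case True
    then show ?thesis using B(3)[OF uB] by (simp add: norm_eq_1)
  next
    case False
    then have "u a \<noteq> u a'" using u by (auto simp: bij_betw_def inj_def)
    then show ?thesis using False B(2) uB by (auto simp: pairwise_def orthogonal_def)
  qed
  have uQ: "column b Q \<bullet> u a = 0" for a b
    using B(1) uB[of a] by (force simp: T_def S_def orthogonal_def span_base)
  \<comment> \<open>The origin selects the columns indexed by \<open>Inr\<close>, so
    \<open>Q\<close> goes there and the added vectors go to the first block.\<close>
  define R0 :: "real^('m + 'k)^('m + 'k)" where
    "R0 = (\<chi> i j. case j of Inl a \<Rightarrow> u a $ i | Inr b \<Rightarrow> Q $ i $ b)"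
  have colR: "column (Inl a) R0 = u a" "column (Inr b) R0 = column b Q" for a b
    by (simp_all add: R0_def column_def vec_eq_iff)
  have "column i R0 \<bullet> column j R0 = (if i = j then 1 else 0)" for i j
    by (cases i; cases j) (simp_all add: colR uu uQ col inner_commute[of "u _" "column _ Q"])
  then have R0: "transpose R0 ** R0 = mat 1"
    by (simp add: matrix_mult_transpose_dot_column mat_def vec_eq_iff)
  have R0Q: "R0 ** stiefel_origin = Q"
    by (simp add: vec_eq_iff mul_stiefel_origin) (simp add: R0_def)
  consider "det R0 = 1" | "det R0 = - 1"
    using det_orthogonal_matrix[of R0] R0 by (auto simp: orthogonal_matrix)
  then show thesis
  proof cases
    case 1
    then show ?thesis using that R0 R0Q by (auto simp: SO_group_iff)
  next
    case 2
    \<comment> \<open>Any index of the first block works: \<open>D\<close> reflects that coordinate,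
      which leaves the origin fixed and negates one added column of \<open>R0\<close>.\<close>
    obtain a0 :: 'm where True by blast
    define s where "s i = (if i = Inl a0 then -1 else (1 :: real))" for i :: "'m + 'k"
    define D :: "real^('m + 'k)^('m + 'k)" where "D = (\<chi> i j. if i = j then s i else 0)"
    have "det D = (\<Prod>i\<in>UNIV. s i)"
      by (subst det_diagonal) (auto simp: D_def)
    also have "\<dots> = -1" by (simp add: s_def prod.delta)
    finally have detD: "det D = -1" .
    have "(transpose D ** D) $ i $ j = (if i = j then 1 else 0)" for i j
    proof -
      have "(transpose D ** D) $ i $ j = (\<Sum>l\<in>UNIV. D $ l $ i * D $ l $ j)"
        by (simp add: matrix_matrix_mult_def transpose_def)
      also have "\<dots> = (\<Sum>l\<in>UNIV. if l = i then (if i = j then 1 else 0) else 0)"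
        by (intro sum.cong) (auto simp: D_def s_def)
      finally show ?thesis by simp
    qed
    then have DD: "transpose D ** D = mat 1"
      by (simp add: vec_eq_iff mat_def)
    have DQ: "D ** stiefel_origin = stiefel_origin"
    proof -
      have "D $ i $ Inr b = stiefel_origin $ i $ b" for i b
        by (cases i) (auto simp: D_def s_def stiefel_origin_component)
      then show ?thesis by (simp add: vec_eq_iff mul_stiefel_origin)
    qed
    have "transpose (R0 ** D) ** (R0 ** D) = transpose D ** (transpose R0 ** R0) ** D"
      by (simp only: matrix_transpose_mul matrix_mul_assoc)
    then have "R0 ** D \<in> SO_group"
      using R0 DD detD 2 by (simp add: SO_group_iff det_mul)
    moreover have "R0 ** D ** stiefel_origin = Q"
      using DQ R0Q by (simp add: matrix_mul_assoc[symmetric])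
    ultimately show ?thesis using that by blast
  qed
qed

section \<open>Group laws, closedness and the homogeneous space\<close>

lemma SO_group_mul: "g \<in> SO_group \<Longrightarrow> h \<in> SO_group \<Longrightarrow> g ** h \<in> SO_group"
  by (simp add: SO_group_def rotation_matrix_def orthogonal_matrix_mul det_mul)

lemma SO_group_transpose: "g \<in> SO_group \<Longrightarrow> transpose g \<in> SO_group"
  by (simp add: SO_group_def rotation_matrix_def)

lemma continuous_on_gram: "continuous_on UNIV (\<lambda>A :: real^'k^'n. transpose A ** A)"
  by (intro bounded_bilinear.continuous_on[OF bounded_bilinear_gram] continuous_on_id)

lemma closed_stiefel: "closed (stiefel :: (real^'k^'n) set)"
  using closed_vimage_Int[of "{mat 1}" UNIV "\<lambda>A :: real^'k^'n. transpose A ** A"] continuous_on_gram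
  by (simp add: stiefel_def vimage_def)

text \<open>Orthogonality is the closed Stiefel condition for square matrices, and the determinant
  is continuous.\<close>

lemma closed_SO_group: "closed (SO_group :: (real^'n^'n) set)"
proof -
  have "closed {R :: real^'n^'n. det R = 1}"
    unfolding det_def by (intro closed_Collect_eq continuous_intros)
  then have "closed (stiefel \<inter> {R :: real^'n^'n. det R = 1})"
    by (intro closed_Int closed_stiefel)
  moreover have "stiefel \<inter> {R :: real^'n^'n. det R = 1} = SO_group"
    by (auto simp: SO_group_iff stiefel_def)
  ultimately show ?thesis by metis
qed

lemma homogeneous_space_stiefel:
  "homogeneous_space SO_group (**) (stiefel :: (real^'k^('m::finite + 'k::finite)) set) stiefel_origin"
proof -
  have "Ck_on r (\<lambda>p :: (real^('m + 'k)^('m + 'k)) \<times> (real^'k^('m + 'k)). fst p ** snd p) UNIV" for r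
    by (intro Ck_on_matrix_mul Ck_on_bounded_linear bounded_linear_fst bounded_linear_snd open_UNIV)
  then have smooth: "smooth_map_on (SO_group \<times> stiefel)
      (\<lambda>(g :: real^('m + 'k)^('m + 'k), Q :: real^'k^('m + 'k)). g ** Q)"
    by (intro smooth_map_on_global) (simp add: case_prod_unfold)
  have "SO_group \<subseteq> {g :: real^('m + 'k)^('m + 'k). invertible g}"
    using SO_inverse by (auto simp: invertible_def)
  then have closed: "closedin (top_of_set {g. invertible g}) (SO_group :: (real^('m + 'k)^('m + 'k)) set)"
    by (intro closed_subset closed_SO_group)
  \<comment> \<open>Rotate \<open>x\<close> back to the origin, then the origin to
    \<open>y\<close>.\<close>
  have trans: "\<exists>g\<in>SO_group. g ** x = y" if "x \<in> stiefel" "y \<in> stiefel" for x y :: "real^'k^('m + 'k)"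
  proof -
    obtain R where R: "R \<in> SO_group" "R ** stiefel_origin = x" using rotation_to_stiefel \<open>x \<in> stiefel\<close> .
    obtain P where P: "P \<in> SO_group" "P ** stiefel_origin = y" using rotation_to_stiefel \<open>y \<in> stiefel\<close> .
    have "P ** transpose R ** x = P ** (transpose R ** R) ** stiefel_origin"
      by (simp only: R(2)[symmetric] matrix_mul_assoc)
    then have "P ** transpose R ** x = y"
      using P SO_inverse(1)[OF R(1)] by simp
    then show ?thesis
      using SO_group_mul[OF P(1) SO_group_transpose[OF R(1)]] by blast
  qed
  have "mat 1 \<in> (SO_group :: (real^('m + 'k)^('m + 'k)) set)" by (simp add: SO_group_iff)
  then show ?thesis
    unfolding homogeneous_space_def
    using smooth closed trans closed_stiefel stiefel_origin_in_stiefel SO_mul_stiefel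
    by (auto simp: SO_group_mul SO_group_transpose SO_inverse matrix_mul_assoc)
qed


subsection \<open>The reductive structure\<close>

lemma transpose_eq_uminus_iff: "transpose A = - A \<longleftrightarrow> (\<forall>i j. A $ j $ i = - A $ i $ j)"
  for A :: "real^'n^'n"
  by (simp add: transpose_def vec_eq_iff)

text \<open>Skewness already ties the off-diagonal blocks together and makes the lower right block
  skew, so the vanishing upper left block is all that remains of the block form.\<close>

lemma stiefel_complement_iff:
  "\<xi> \<in> stiefel_complement \<longleftrightarrow> \<xi> \<in> so_algebra \<and> (\<forall>a a'. \<xi> $ Inl a $ Inl a' = 0)"
  for \<xi> :: "real^('m::finite + 'k::finite)^('m + 'k)"
proof
  assume "\<xi> \<in> stiefel_complement"
  then obtain W \<Omega> where \<xi>: "\<xi> = block_matrix 0 W (- transpose W) \<Omega>" and "transpose \<Omega> = - \<Omega>"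
    by (auto simp: stiefel_complement_def)
  then have \<Omega>: "\<Omega> $ j $ i = - \<Omega> $ i $ j" for i j
    using transpose_eq_uminus_iff by blast
  \<comment> \<open>The instance with \<open>projr\<close> matters only when both indices lie in the
    second block, where \<open>projr\<close> removes \<open>Inr\<close>.\<close>
  have "\<xi> $ j $ i = - \<xi> $ i $ j" for i j
    using \<Omega>[of "projr i" "projr j"]
    by (cases i; cases j) (simp_all add: \<xi> block_matrix_def transpose_def)
  then have "\<xi> \<in> so_algebra"
    unfolding so_algebra_def transpose_eq_uminus_iff by blast
  then show "\<xi> \<in> so_algebra \<and> (\<forall>a a'. \<xi> $ Inl a $ Inl a' = 0)"
    by (simp add: \<xi> block_matrix_def)
next
  assume *: "\<xi> \<in> so_algebra \<and> (\<forall>a a'. \<xi> $ Inl a $ Inl a' = 0)"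
  then have skew: "\<xi> $ j $ i = - \<xi> $ i $ j" for i j
    unfolding so_algebra_def transpose_eq_uminus_iff by blast
  define W \<Omega> where "W = (\<chi> a b. \<xi> $ Inl a $ Inr b)" and "\<Omega> = (\<chi> b b'. \<xi> $ Inr b $ Inr b')"
  have "\<xi> $ i $ j = block_matrix 0 W (- transpose W) \<Omega> $ i $ j" for i j
    using * skew[of i j]
    by (cases i; cases j) (simp_all add: block_matrix_def W_def \<Omega>_def transpose_def)
  then have "\<xi> = block_matrix 0 W (- transpose W) \<Omega>" by (simp add: vec_eq_iff)
  moreover have "transpose \<Omega> = - \<Omega>"
    unfolding transpose_eq_uminus_iff using skew by (metis (no_types, lifting) \<Omega>_def vec_lambda_beta)
  ultimately show "\<xi> \<in> stiefel_complement"
    by (auto simp: stiefel_complement_def)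
qed

text \<open>In the lower right block the second and third terms of the form cancel; elsewhere the
  third term vanishes.\<close>

lemma stiefel_form_origin_component:
  "stiefel_form stiefel_origin f $ Inl a $ Inl a' = 0"
  "stiefel_form stiefel_origin f $ Inl a $ Inr b = f $ Inl a $ b"
  "stiefel_form stiefel_origin f $ Inr b $ Inl a = - f $ Inl a $ b"
  "stiefel_form stiefel_origin f $ Inr b $ Inr b' = f $ Inr b $ b'"
proof -
  have "transpose f $ i $ j = f $ j $ i" for i j by (simp add: transpose_def)
  then show "stiefel_form stiefel_origin f $ Inl a $ Inl a' = 0"
    "stiefel_form stiefel_origin f $ Inl a $ Inr b = f $ Inl a $ b"
    "stiefel_form stiefel_origin f $ Inr b $ Inl a = - f $ Inl a $ b"
    "stiefel_form stiefel_origin f $ Inr b $ Inr b' = f $ Inr b $ b'"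
    by (simp_all add: stiefel_form_def stiefel_origin_mul mul_stiefel_origin mul_transpose_stiefel_origin)
qed

text \<open>The product with the origin retains the last columns of \<open>\<xi>\<close>; skewness
  and the zero block restore the rest. Thus an element of the complement is determined by its
  velocity at the origin.\<close>

lemma stiefel_form_origin_self:
  assumes "\<xi> \<in> stiefel_complement"
  shows "stiefel_form stiefel_origin (\<xi> ** stiefel_origin) = \<xi>"
proof -
  have skew: "\<xi> $ j $ i = - \<xi> $ i $ j" for i j
    using assms unfolding stiefel_complement_iff so_algebra_def transpose_eq_uminus_iff by blast
  have zero: "\<xi> $ Inl a $ Inl a' = 0" for a a'
    using assms by (simp add: stiefel_complement_iff)
  have "stiefel_form stiefel_origin (\<xi> ** stiefel_origin) $ i $ j = \<xi> $ i $ j" for i j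
    using skew[of i j] by (cases i; cases j) (simp_all add: stiefel_form_origin_component mul_stiefel_origin zero)
  then show ?thesis by (simp add: vec_eq_iff)
qed

lemma so_algebra_mul_tangent:
  assumes "\<xi> \<in> so_algebra"
  shows "transpose (\<xi> ** Q) ** Q = - (transpose Q ** (\<xi> ** Q))"
  using assms by (simp add: so_algebra_def matrix_algebra_simps)

lemma stiefel_form_origin_in_complement:
  assumes "transpose f ** stiefel_origin = - (transpose stiefel_origin ** f)"
  shows "stiefel_form stiefel_origin f \<in> stiefel_complement"
  using stiefel_form_skew[OF stiefel_origin_in_stiefel assms]
  by (simp add: stiefel_complement_iff stiefel_form_origin_component)

lemma stiefel_form_origin_image:
  "stiefel_form stiefel_origin ` tangent_space stiefel stiefel_origin = stiefel_complement"
proof (intro equalityI subsetI)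
  fix \<xi> assume "\<xi> \<in> stiefel_form stiefel_origin ` tangent_space stiefel stiefel_origin"
  then show "\<xi> \<in> stiefel_complement"
    by (auto simp: tangent_space_stiefel[OF stiefel_origin_in_stiefel] stiefel_form_origin_in_complement)
next
  fix \<xi> :: "real^('m::finite + 'k::finite)^('m + 'k)"
  assume \<xi>: "\<xi> \<in> stiefel_complement"
  then have "\<xi> ** stiefel_origin \<in> tangent_space stiefel stiefel_origin"
    by (simp add: tangent_space_stiefel[OF stiefel_origin_in_stiefel] so_algebra_mul_tangent
        stiefel_complement_iff)
  then show "\<xi> \<in> stiefel_form stiefel_origin ` tangent_space stiefel stiefel_origin"
    using stiefel_form_origin_self[OF \<xi>] by (metis imageI)
qed

lemma subspace_so_algebra: "subspace so_algebra"
  by (auto simp: subspace_def so_algebra_def transpose_linear_simps)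

lemma reductive_structure_stiefel:
  "reductive_structure SO_group (**) (stiefel_origin :: real^'k^('m::finite + 'k::finite)) stiefel_complement"
proof -
  let ?Q = "stiefel_origin :: real^'k^('m + 'k)"
  let ?m = "stiefel_complement :: (real^('m + 'k)^('m + 'k)) set"
  have m_so: "?m \<subseteq> so_algebra" by (auto simp: stiefel_complement_iff)
  have "subspace ?m"
    using subspace_so_algebra by (auto simp: subspace_def stiefel_complement_iff)
  moreover have "so_algebra = {a + b |a b. a \<in> {\<xi> \<in> so_algebra. \<xi> ** ?Q = 0} \<and> b \<in> ?m}"
  proof (intro equalityI subsetI)
    fix \<xi> :: "real^('m + 'k)^('m + 'k)" assume \<xi>: "\<xi> \<in> so_algebra"
    \<comment> \<open>The candidate component in the complement: it moves the origin with the same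
      velocity as \<open>\<xi>\<close>, so \<open>\<xi> - b\<close> annihilates the origin.\<close>
    define b where "b = stiefel_form ?Q (\<xi> ** ?Q)"
    have b: "b \<in> ?m"
      unfolding b_def by (rule stiefel_form_origin_in_complement[OF so_algebra_mul_tangent[OF \<xi>]])
    moreover have "b ** ?Q = \<xi> ** ?Q"
      unfolding b_def
      by (rule stiefel_form_action[OF stiefel_origin_in_stiefel so_algebra_mul_tangent[OF \<xi>]])
    moreover have "\<xi> - b \<in> so_algebra"
      using subspace_so_algebra \<xi> b m_so by (auto intro: subspace_diff)
    ultimately show "\<xi> \<in> {a + b |a b. a \<in> {\<xi> \<in> so_algebra. \<xi> ** ?Q = 0} \<and> b \<in> ?m}"
      by (intro CollectI exI[of _ "\<xi> - b"] exI[of _ b]) (simp add: matrix_mul_linear_simps)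
  next
    fix \<xi> :: "real^('m + 'k)^('m + 'k)"
    assume "\<xi> \<in> {a + b |a b. a \<in> {\<xi> \<in> so_algebra. \<xi> ** ?Q = 0} \<and> b \<in> ?m}"
    then show "\<xi> \<in> so_algebra"
      using subspace_so_algebra m_so by (auto intro: subspace_add)
  qed
  moreover have "{\<xi> \<in> so_algebra. \<xi> ** ?Q = 0} \<inter> ?m = {0}"
  proof (intro equalityI subsetI)
    fix \<xi> assume "\<xi> \<in> {\<xi> \<in> so_algebra. \<xi> ** ?Q = 0} \<inter> ?m"
    \<comment> \<open>An element of the intersection has velocity zero at the origin and is
      recovered from that velocity.\<close>
    then have "\<xi> = stiefel_form ?Q 0"
      using stiefel_form_origin_self[of \<xi>] by auto
    then show "\<xi> \<in> {0}" by (simp add: stiefel_form_def matrix_algebra_simps)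
  qed (use \<open>subspace ?m\<close> subspace_0 m_so in \<open>auto simp: matrix_mul_linear_simps\<close>)
  moreover have "adjoint_action g \<xi> \<in> ?m"
    if g: "g \<in> isotropy_group SO_group (**) ?Q" and \<xi>: "\<xi> \<in> ?m" for g \<xi>
  proof -
    have g': "g \<in> SO_group" "g ** ?Q = ?Q" using g by (auto simp: isotropy_group_def)
    have "transpose g ** ?Q = transpose g ** (g ** ?Q)" by (simp add: g')
    then have gQ: "transpose g ** ?Q = ?Q" by (simp add: matrix_mul_assoc SO_inverse[OF g'(1)])
    have so: "adjoint_action g \<xi> \<in> so_algebra"
      using \<xi> by (simp add: stiefel_complement_iff so_algebra_def adjoint_action_def
          SO_inverse[OF g'(1)] matrix_algebra_simps)
    have "adjoint_action g \<xi> ** ?Q = g ** (\<xi> ** ?Q)"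
      by (simp add: adjoint_action_def SO_inverse[OF g'(1)] matrix_mul_assoc[symmetric] gQ)
    \<comment> \<open>Equivariance at the fixed point \<open>?Q\<close> shows that the conjugate is
      the form of its own velocity, hence in the complement.\<close>
    moreover have "adjoint_action g \<xi> = stiefel_form ?Q (g ** (\<xi> ** ?Q))"
      using stiefel_form_equivariant[OF g'(1), of ?Q "\<xi> ** ?Q"]
      by (simp add: stiefel_form_origin_self[OF \<xi>] g')
    ultimately have "adjoint_action g \<xi> = stiefel_form ?Q (adjoint_action g \<xi> ** ?Q)" by simp
    then show ?thesis
      using stiefel_form_origin_in_complement[OF so_algebra_mul_tangent[OF so]] by metis
  qed
  ultimately show ?thesis
    using m_so by (simp add: reductive_structure_def Let_def lie_algebra_SO lie_algebra_isotropy)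
qed

text \<open>Uniqueness: at the origin a competing connection takes values in the complement with
  prescribed velocity, which determines them; equivariance and transitivity carry this to every
  point.\<close>

lemma associated_connection_stiefel_form:
  "is_associated_connection SO_group (**) stiefel (stiefel_origin :: real^'k^('m::finite + 'k::finite))
     stiefel_complement stiefel_form"
proof -
  let ?Q = "stiefel_origin :: real^'k^('m + 'k)"
  have "\<omega> x f = stiefel_form x f"
    if \<omega>: "connection SO_group (**) stiefel \<omega>" "\<omega> ?Q ` tangent_space stiefel ?Q = stiefel_complement"
      and x: "x \<in> stiefel" and f: "f \<in> tangent_space stiefel x" for \<omega> and x f :: "real^'k^('m + 'k)"
  proof -
    have origin: "\<omega> ?Q h = stiefel_form ?Q h" if h: "h \<in> tangent_space stiefel ?Q" for h
    proof -
      have "\<omega> ?Q h ** ?Q = h"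
        using \<omega>(1) h stiefel_origin_in_stiefel
        by (auto simp: connection_def infinitesimal_action_matrix_mul)
      moreover have "\<omega> ?Q h \<in> stiefel_complement" using \<omega>(2) h by blast
      ultimately show ?thesis using stiefel_form_origin_self by metis
    qed
    obtain g where g: "g \<in> SO_group" "g ** ?Q = x"
      using rotation_to_stiefel[OF x] .
    \<comment> \<open>The tangent vector \<open>f\<close> pulled back to the origin by the inverse
      rotation.\<close>
    define h where "h = transpose g ** f"
    have gh: "g ** h = f" by (simp add: h_def matrix_mul_assoc SO_inverse[OF g(1)])
    have "transpose f ** x = transpose h ** (transpose g ** g) ** ?Q"
      "transpose x ** f = transpose ?Q ** (transpose g ** g) ** h"
      by (simp_all only: gh[symmetric] g(2)[symmetric] matrix_transpose_mul matrix_mul_assoc)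
    then have h: "h \<in> tangent_space stiefel ?Q"
      using f by (simp add: tangent_space_stiefel x stiefel_origin_in_stiefel SO_inverse[OF g(1)])
    have "\<omega> (g ** ?Q) (g ** h) = adjoint_action g (\<omega> ?Q h)"
      using \<omega>(1) g(1) h stiefel_origin_in_stiefel
      by (auto simp: connection_def tangent_map_matrix_mul)
    then show ?thesis
      using stiefel_form_equivariant[OF g(1), of ?Q h] by (simp add: g gh origin[OF h])
  qed
  then show ?thesis
    unfolding is_associated_connection_def
    using connection_stiefel_form stiefel_form_origin_image by blast
qed


subsection \<open>Symmetry\<close>

text \<open>The only entry is diagonal, hence its own negative.\<close>

lemma skew_eq_0_dimension_1:
  fixes A :: "real^'k^'k"
  assumes "transpose A = - A" "CARD('k) = 1"
  shows "A = 0"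
proof -
  have "i = j" for i j :: 'k using assms(2) by (metis card_1_singletonE UNIV_I singletonD)
  moreover have "A $ j $ i = - A $ i $ j" for i j
    using assms(1) transpose_eq_uminus_iff by blast
  ultimately have "A $ i $ j = 0" for i j
    by (metis add.inverse_neutral neg_equal_zero)
  then show ?thesis by (simp add: vec_eq_iff)
qed

lemma lie_bracket_so_algebra:
  "\<xi> \<in> so_algebra \<Longrightarrow> \<eta> \<in> so_algebra \<Longrightarrow> lie_bracket \<xi> \<eta> \<in> so_algebra"
  by (simp add: so_algebra_def lie_bracket_def matrix_algebra_simps)

text \<open>Brackets of skew matrices are skew, so membership in the isotropy algebra reduces to
  annihilating the origin.\<close>

lemma symmetric_stiefel_form_iff:
  "symmetric_connection SO_group (**) stiefel (stiefel_origin :: real^'k^('m::finite + 'k::finite)) stiefel_form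
     \<longleftrightarrow> CARD('k) = 1"
proof -
  let ?Q = "stiefel_origin :: real^'k^('m + 'k)"
  let ?m = "stiefel_complement :: (real^('m + 'k)^('m + 'k)) set"
  have "(\<forall>\<xi>\<in>?m. \<forall>\<eta>\<in>?m. lie_bracket \<xi> \<eta> ** ?Q = 0) \<longleftrightarrow> CARD('k) = 1"
  proof
    assume *: "\<forall>\<xi>\<in>?m. \<forall>\<eta>\<in>?m. lie_bracket \<xi> \<eta> ** ?Q = 0"
    have "b = b'" for b b' :: 'k
    proof (rule ccontr)
      assume "b \<noteq> b'"
      obtain a :: 'm where True by blast
      \<comment> \<open>Elements of the complement with \<open>\<Omega> = 0\<close> and
        \<open>W\<close> the unit matrix with its entry \<open>1\<close> in row \<open>a\<close> and
        column \<open>c\<close>.\<close>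
      define \<xi> :: "'k \<Rightarrow> real^('m + 'k)^('m + 'k)" where
        "\<xi> c = (\<chi> i j. (if i = Inl a \<and> j = Inr c then 1 else 0) - (if i = Inr c \<and> j = Inl a then 1 else 0))" for c
      have m: "\<xi> c \<in> ?m" for c
        by (simp add: stiefel_complement_iff so_algebra_def \<xi>_def transpose_def vec_eq_iff)
      have "(\<xi> c ** \<xi> c') $ Inr b $ Inr b' = - of_bool (c = b \<and> c' = b')" for c c'
      proof -
        have "(\<Sum>x\<in>UNIV. \<xi> c $ Inr b $ Inl x * \<xi> c' $ Inl x $ Inr b')
            = (\<Sum>x\<in>UNIV. if x = a then - of_bool (c = b \<and> c' = b') else 0)"
          by (intro sum.cong) (auto simp: \<xi>_def)
        moreover have "\<xi> c $ Inr b $ Inr x = 0" for x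
          by (simp add: \<xi>_def)
        ultimately show ?thesis
          by (simp add: matrix_matrix_mult_def sum_UNIV_sum)
      qed
      \<comment> \<open>Only the product with \<open>c = b\<close> and \<open>c' = b'\<close>
        contributes; in the opposite order this entry is \<open>0\<close>.\<close>
      then have "(lie_bracket (\<xi> b) (\<xi> b') ** ?Q) $ Inr b $ b' = - 1"
        using \<open>b \<noteq> b'\<close> by (simp add: mul_stiefel_origin lie_bracket_def)
      with * m show False by simp
    qed
    then have "(UNIV :: 'k set) = {undefined}" by auto
    then show "CARD('k) = 1" by (metis One_nat_def card_1_singleton_iff)
  next
    assume k: "CARD('k) = 1"
    have "lie_bracket \<xi> \<eta> ** ?Q = 0" if "\<xi> \<in> ?m" "\<eta> \<in> ?m" for \<xi> \<eta>
    proof -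
      have so: "\<xi> \<in> so_algebra" "\<eta> \<in> so_algebra" using that by (auto simp: stiefel_complement_iff)
      \<comment> \<open>Compression to the lower right block preserves skewness, so this block
        vanishes when it has size one.\<close>
      have corner: "transpose ?Q ** \<zeta> ** ?Q = 0" if "\<zeta> \<in> so_algebra" for \<zeta>
        using that by (intro skew_eq_0_dimension_1[OF _ k]) (simp add: so_algebra_def matrix_algebra_simps)
      have zero: "\<zeta> $ Inr b $ Inr b' = 0" if "\<zeta> \<in> so_algebra" for \<zeta> :: "real^('m + 'k)^('m + 'k)" and b b'
      proof -
        have "(transpose ?Q ** (\<zeta> ** ?Q)) $ b $ b' = 0"
          using corner[OF that] by (simp add: matrix_mul_assoc)
        then show ?thesis by (simp add: transpose_stiefel_origin_mul mul_stiefel_origin)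
      qed
      \<comment> \<open>Through the first block the product meets the zero corner of
        \<open>\<alpha>\<close>, through the second the zero corner of
        \<open>\<beta>\<close>.\<close>
      have upper: "(\<alpha> ** \<beta>) $ Inl a $ Inr b = 0" if "\<alpha> \<in> ?m" "\<beta> \<in> ?m" for \<alpha> \<beta> a b
        using that zero[of \<beta>]
        by (simp add: stiefel_complement_iff matrix_matrix_mult_def sum_UNIV_sum)
      have "(lie_bracket \<xi> \<eta> ** ?Q) $ i $ j = 0" for i j
        using upper that zero[OF lie_bracket_so_algebra[OF so]]
        by (cases i) (simp_all add: mul_stiefel_origin lie_bracket_def)
      then show ?thesis by (simp add: vec_eq_iff)
    qed
    then show "\<forall>\<xi>\<in>?m. \<forall>\<eta>\<in>?m. lie_bracket \<xi> \<eta> ** ?Q = 0" by blast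
  qed
  moreover have "lie_bracket \<xi> \<eta> \<in> so_algebra" if "\<xi> \<in> ?m" "\<eta> \<in> ?m" for \<xi> \<eta>
    using that by (simp add: lie_bracket_so_algebra stiefel_complement_iff)
  ultimately show ?thesis
    unfolding symmetric_connection_def Let_def stiefel_form_origin_image lie_algebra_isotropy by blast
qed

text \<open>The Gram matrix has a single entry, the squared norm of the only column.\<close>

lemma stiefel_eq_sphere:
  assumes "CARD('k) = 1"
  shows "(stiefel :: (real^'k^'n) set) = columnvector ` sphere 0 1"
proof -
  obtain i :: 'k where "UNIV = {i}" using assms by (metis card_1_singletonE)
  then have all: "(\<forall>j. P j) \<longleftrightarrow> P i" for P
    by (metis UNIV_I singletonD)
  have iff: "Q \<in> stiefel \<longleftrightarrow> norm (column i Q) = 1" for Q :: "real^'k^'n"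
    by (simp add: stiefel_def matrix_mult_transpose_dot_column mat_def vec_eq_iff norm_eq_1 all)
  have "column i (columnvector v :: real^'k^'n) = v" for v
    by (simp add: column_def columnvector_def vec_eq_iff)
  moreover have "columnvector (column i Q) = Q" for Q :: "real^'k^'n"
    by (simp add: column_def columnvector_def vec_eq_iff all)
  ultimately show ?thesis
    using iff by (auto simp: image_iff) (metis mem_sphere_0)
qed

text \<open>By tangency \<open>transpose f ** Q\<close> is skew of size one, hence zero, and the
  third term contains it as a factor.\<close>

lemma stiefel_form_dimension_1:
  fixes Q f :: "real^'k^'n"
  assumes "CARD('k) = 1" "Q \<in> stiefel" "f \<in> tangent_space stiefel Q"
  shows "stiefel_form Q f = f ** transpose Q - Q ** transpose f"
proof -
  have "transpose (transpose f ** Q) = - (transpose f ** Q)"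
    using assms(2,3) by (simp add: tangent_space_stiefel matrix_transpose_mul transpose_linear_simps)
  then have "transpose f ** Q = 0"
    using assms(1) by (rule skew_eq_0_dimension_1)
  then have "Q ** (transpose f ** Q) ** transpose Q = 0"
    by (simp add: matrix_mul_linear_simps)
  then show ?thesis
    by (simp add: stiefel_form_def matrix_mul_assoc)
qed

theorem proposition5p4:
  fixes n k :: nat
    and G :: "(real^('m::finite + 'k::finite)^('m + 'k)) set"
    and M :: "(real^'k^('m + 'k)) set"
    and Q\<^sub>0 :: "real^'k^('m + 'k)"
    and \<mm> :: "(real^('m + 'k)^('m + 'k)) set"
  assumes "1 \<le> k" and "k < n"
    and "CARD('m) = n - k" and "CARD('k) = k"
    and "G = SO_group" and "M = stiefel" and "Q\<^sub>0 = stiefel_origin" and "\<mm> = stiefel_complement"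
  shows "homogeneous_space G (**) M Q\<^sub>0 \<and>
    reductive_structure G (**) Q\<^sub>0 \<mm> \<and>
    (\<exists>\<omega>. is_associated_connection G (**) M Q\<^sub>0 \<mm> \<omega> \<and>
      (\<forall>Q\<in>M. \<forall>\<delta>Q\<in>tangent_space M Q.
         \<omega> Q \<delta>Q = \<delta>Q ** transpose Q - Q ** transpose \<delta>Q + Q ** transpose \<delta>Q ** Q ** transpose Q) \<and>
      (symmetric_connection G (**) M Q\<^sub>0 \<omega> \<longleftrightarrow> k = 1) \<and>
      (k = 1 \<longrightarrow> M = columnvector ` sphere 0 1 \<and>
        (\<forall>Q\<in>M. \<forall>\<delta>Q\<in>tangent_space M Q.
           \<omega> Q \<delta>Q = \<delta>Q ** transpose Q - Q ** transpose \<delta>Q)))"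
  unfolding assms(5-8)
proof (intro conjI exI[of _ stiefel_form])
  show "symmetric_connection SO_group (**) stiefel (stiefel_origin :: real^'k^('m + 'k)) stiefel_form
      \<longleftrightarrow> k = 1"
    using symmetric_stiefel_form_iff assms(4) by metis
  show "k = 1 \<longrightarrow> (stiefel :: (real^'k^('m + 'k)) set) = columnvector ` sphere 0 1 \<and>
      (\<forall>Q\<in>(stiefel :: (real^'k^('m + 'k)) set). \<forall>\<delta>Q\<in>tangent_space stiefel Q.
        stiefel_form Q \<delta>Q = \<delta>Q ** transpose Q - Q ** transpose \<delta>Q)"
    using stiefel_eq_sphere stiefel_form_dimension_1 assms(4) by auto
qed (auto simp: homogeneous_space_stiefel reductive_structure_stiefel
    associated_connection_stiefel_form stiefel_form_def)

end
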